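(* Let $F^n=(M,F)$ be a Finsler space, $i:\check M\to M$ an immersed $m$-dimensional manifold ($1<m<n$), $D$ the Cartan metrical $N$-linear connection on $\widetilde{OscM}$ with coefficients $(L^{H\,a}{}_{bc},L^{V\,a}{}_{bc},C^{H\,a}{}_{bc},C^{V\,a}{}_{bc})$, and $\check N$ the induced nonlinear connection on $\widetilde{Osc\check M}$. Then the coupling of $D$ to $\check N$ along $\widetilde{Osc\check M}$ is locally given by the set of coefficients $(\check L^{H\,a}{}_{b\delta},\check L^{V\,a}{}_{b\delta},\check C^{H\,a}{}_{b\delta},\check C^{V\,a}{}_{b\delta})$, i.e. its connection 1-forms are $$\check\omega^{H\,a}{}_{b}=\check L^{H\,a}{}_{b\delta}\,du^\delta+\check C^{H\,a}{}_{b\delta}\,\delta v^\delta,\qquad \check\omega^{V\,a}{}_{b}=\check L^{V\,a}{}_{b\delta}\,du^\delta+\check C^{V\,a}{}_{b\delta}\,\delta v^\delta,$$ where $$\check L^{H\,a}{}_{b\delta}=L^{H\,a}{}_{bd}B^d_\delta+C^{H\,a}{}_{bd}B^d_{\bar\delta}K^{\bar\delta}_\delta,\qquad \check L^{V\,a}{}_{b\delta}=L^{V\,a}{}_{bd}B^d_\delta+C^{V\,a}{}_{bd}B^d_{\bar\delta}K^{\bar\delta}_\delta,$$ $$\check C^{H\,a}{}_{b\delta}=C^{H\,a}{}_{bd}B^d_\delta,\qquad \check C^{V\,a}{}_{b\delta}=C^{V\,a}{}_{bd}B^d_\delta .$$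
   Context: Summation convention throughout. Indices $a,b,c,d,f$ run over $1,\dots,n$; $\alpha,\beta,\gamma,\delta$ over $1,\dots,m$; barred indices $\bar\alpha,\bar\beta,\bar\delta$ over $1,\dots,n-m$. Ambient space. $M$ is a real $n$-manifold, $OscM=TM$ with local coordinates $(x^a,y^a)$, $\widetilde{OscM}=TM\setminus\{0\}$. $F$ is a Finsler fundamental function on $M$ (smooth on $\widetilde{OscM}$, continuous on the null section), $g_{ab}=\frac12\frac{\partial^2F^2}{\partial y^a\partial y^b}$, $\gamma^a_{bc}(x,y)$ are the Christoffel symbols of $g_{ab}$ formed with $x$-derivatives, $G^a=\frac12\gamma^a_{bc}y^by^c$, and $N^a{}_b=\partial G^a/\partial y^b$ is the Cartan nonlinear connection. Put $\dot\partial_a=\partial/\partial y^a$, $\delta_a=\partial/\partial x^a-N^b{}_a\dot\partial_b$, $\delta y^a=dy^a+N^a{}_bdx^b$. Let $p>0$ be a constant, $\|y\|^2=g_{ab}y^ay^b$, $h_{ab}=\frac{p^2}{\|y\|^2}g_{ab}$, with inverse $h^{ab}$. The homogeneous lift is $\mathring{\mathbb G}=g_{ab}dx^a\otimes dx^b+h_{ab}\delta y^a\otimes\delta y^b$. The Cartan metrical $N$-linear connection $D$ has the coefficients $L^{H\,a}{}_{bc}=\frac12g^{ad}(\delta_bg_{dc}+\delta_cg_{bd}-\delta_dg_{bc})$, $L^{V\,a}{}_{bc}=\frac12h^{ad}(\delta_bh_{dc}+\delta_ch_{bd}-\delta_dh_{bc})$, $C^{H\,a}{}_{bc}=\frac12g^{ad}(\dot\partial_bg_{dc}+\dot\partial_cg_{bd}-\dot\partial_dg_{bc})$,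 $C^{V\,a}{}_{bc}=\frac12h^{ad}(\dot\partial_bh_{dc}+\dot\partial_ch_{bd}-\dot\partial_dh_{bc})$, and connection 1-forms $\omega^{H\,a}{}_b=L^{H\,a}{}_{bc}dx^c+C^{H\,a}{}_{bc}\delta y^c$, $\omega^{V\,a}{}_b=L^{V\,a}{}_{bc}dx^c+C^{V\,a}{}_{bc}\delta y^c$. Submanifold. $i$ is locally $x^a=x^a(u^1,\dots,u^m)$ with $B^a_\alpha=\partial x^a/\partial u^\alpha$ of rank $m$; $Osc\check M=T\check M$ with coordinates $(u^\alpha,v^\alpha)$ is immersed in $OscM$ by $x^a=x^a(u)$, $y^a=B^a_\alpha v^\alpha$; $\widetilde{Osc\check M}=T\check M\setminus\{0\}$. Along it one fixes a local moving frame $\{B^a_\alpha(u),B^a_{\bar\alpha}(u,v)\}$ with dual frame $\{B^\alpha_a(u,v),B^{\bar\alpha}_a(u,v)\}$: $B^a_\beta B^\alpha_a=\delta^\alpha_\beta$, $B^a_\beta B^{\bar\alpha}_a=0$, $B^\alpha_aB^a_{\bar\beta}=0$, $B^{\bar\alpha}_aB^a_{\bar\beta}=\delta^{\bar\alpha}_{\bar\beta}$, $B^a_\alpha B^\alpha_b+B^a_{\bar\alpha}B^{\bar\alpha}_b=\delta^a_b$. Put $B^a_{\alpha\beta}=\partial^2x^a/\partial u^\alpha\partial u^\beta$, $B^a_{0\beta}=B^a_{\alpha\beta}v^\alpha$. The induced nonlinear connection is $\check N^\alpha{}_\beta=B^\alpha_a(B^a_{0\beta}+N^a{}_bB^b_\beta)$,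 $\delta v^\alpha=dv^\alpha+\check N^\alpha{}_\beta du^\beta$, and $K^{\bar\alpha}_\beta=B^{\bar\alpha}_a(B^a_{0\beta}+N^a{}_bB^b_\beta)$. (All ambient functions are evaluated along the submanifold.) The coupling of $D$ to $\check N$ is the pair of operators $\check D^HX^a=dX^a+\check\omega^{H\,a}{}_bX^b$, $\check D^VX^a=dX^a+\check\omega^{V\,a}{}_bX^b$, for $X^a$ defined along $\widetilde{Osc\check M}$, where $\check\omega^{H\,a}{}_b$, $\check\omega^{V\,a}{}_b$ are the pullbacks (restrictions) of $\omega^{H\,a}{}_b$, $\omega^{V\,a}{}_b$ to $\widetilde{Osc\check M}$, expressed in the cobasis $(du^\delta,\delta v^\delta)$. *)

theory Defs
  imports "HOL-Analysis.Analysis"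
begin

section \<open>Smooth maps and smooth manifolds\<close>

primrec Ck_on :: "nat \<Rightarrow> ('a::euclidean_space \<Rightarrow> 'b::euclidean_space) \<Rightarrow> 'a set \<Rightarrow> bool" where
  "Ck_on 0 f S = continuous_on S f"
| "Ck_on (Suc k) f S = ((\<forall>x\<in>S. f differentiable (at x)) \<and>
     (\<forall>v. Ck_on k (\<lambda>x. frechet_derivative f (at x) v) S))"

text \<open>Only used for open \<open>S\<close>, where it is the usual notion of class \<open>C\<^sup>\<infinity>\<close>.\<close>
definition smooth_on :: "('a::euclidean_space \<Rightarrow> 'b::euclidean_space) \<Rightarrow> 'a set \<Rightarrow> bool" where
  "smooth_on f S \<longleftrightarrow> (\<forall>k. Ck_on k f S)"

text \<open>A chart is a pair of a domain and a coordinate map. The underlying set of a manifold is a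
  whole type; Hausdorff and second countable are expressed by its type class.\<close>
type_synonym ('p, 'n) chart = "'p set \<times> ('p \<Rightarrow> real^'n)"

definition chart_image :: "('p, 'n::finite) chart \<Rightarrow> (real^'n) set" where
  "chart_image c = snd c ` fst c"

definition chart_inv :: "('p, 'n::finite) chart \<Rightarrow> real^'n \<Rightarrow> 'p" where
  "chart_inv c = inv_into (fst c) (snd c)"

definition smooth_manifold ::
    "('p::{t2_space,second_countable_topology}, 'n::finite) chart set \<Rightarrow> bool" where
  "smooth_manifold A \<longleftrightarrow>
     (\<Union>c\<in>A. fst c) = UNIV \<and>
     (\<forall>c\<in>A. open (fst c) \<and> open (chart_image c) \<and>
        homeomorphism (fst c) (chart_image c) (snd c) (chart_inv c)) \<and>
     (\<forall>c\<in>A. \<forall>d\<in>A. smooth_on (snd d \<circ> chart_inv c) (snd c ` (fst c \<inter> fst d)))"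

definition local_rep ::
    "('q, 'm::finite) chart \<Rightarrow> ('p, 'n::finite) chart \<Rightarrow> ('q \<Rightarrow> 'p) \<Rightarrow> real^'m \<Rightarrow> real^'n" where
  "local_rep c' c i = snd c \<circ> i \<circ> chart_inv c'"

definition immersion ::
    "('q::{t2_space,second_countable_topology}, 'm::finite) chart set \<Rightarrow>
     ('p::{t2_space,second_countable_topology}, 'n::finite) chart set \<Rightarrow> ('q \<Rightarrow> 'p) \<Rightarrow> bool" where
  "immersion A' A i \<longleftrightarrow> continuous_on UNIV i \<and>
     (\<forall>c'\<in>A'. \<forall>c\<in>A. smooth_on (local_rep c' c i) (snd c' ` (fst c' \<inter> i -` fst c)) \<and>
        (\<forall>u \<in> snd c' ` (fst c' \<inter> i -` fst c).
           rank (jacobian (local_rep c' c i) (at u)) = CARD('m)))"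

text \<open>A tangent vector is represented by its base point together with the family of its
  components in all charts around that point (\<open>0\<close> for the other charts); the components transform
  by the differential of the coordinate change. \<open>tangent_point A c (x, y)\<close> is the tangent vector
  with coordinates \<open>(x, y)\<close> in the chart of \<open>TM\<close> induced by \<open>c\<close>.\<close>
type_synonym ('p, 'n) tvec = "'p \<times> (('p, 'n) chart \<Rightarrow> real^'n)"

definition tangent_point ::
    "('p, 'n::finite) chart set \<Rightarrow> ('p, 'n) chart \<Rightarrow> (real^'n) \<times> (real^'n) \<Rightarrow> ('p, 'n) tvec" where
  "tangent_point A c = (\<lambda>(x, y). (chart_inv c x,
     \<lambda>d. if d \<in> A \<and> chart_inv c x \<in> fst d
         then frechet_derivative (snd d \<circ> chart_inv c) (at x) y else 0))"

section \<open>Local Finsler geometry on \<open>TM\<close>\<close>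

text \<open>In this section \<open>F\<close> is the expression of the fundamental function in induced local
  coordinates \<open>(x, y)\<close> of \<open>TM\<close>. Vectors tangent to \<open>TM\<close> are pairs as well, so that
  \<open>1\<close>-forms on \<open>TM\<close> are functions of a point and a pair.\<close>

type_synonym 'n point = "(real^'n) \<times> (real^'n)"
type_synonym 'n coeffs = "'n \<Rightarrow> 'n \<Rightarrow> 'n \<Rightarrow> 'n point \<Rightarrow> real"
type_synonym 'n form = "'n point \<Rightarrow> 'n point \<Rightarrow> real"

definition d_x :: "'n::finite \<Rightarrow> ('n point \<Rightarrow> real) \<Rightarrow> 'n point \<Rightarrow> real" where
  "d_x a f z = frechet_derivative f (at z) (axis a 1, 0)"

definition d_y :: "'n::finite \<Rightarrow> ('n point \<Rightarrow> real) \<Rightarrow> 'n point \<Rightarrow> real" where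
  "d_y a f z = frechet_derivative f (at z) (0, axis a 1)"

definition metric_g :: "('n::finite point \<Rightarrow> real) \<Rightarrow> 'n point \<Rightarrow> real^'n^'n" where
  "metric_g F z = (\<chi> a b. 1/2 * d_y a (d_y b (\<lambda>w. (F w)\<^sup>2)) z)"

text \<open>The Christoffel expression
  \<open>1/2 m\<^sup>a\<^sup>d (\<partial>\<^sub>b m\<^sub>d\<^sub>c + \<partial>\<^sub>c m\<^sub>b\<^sub>d - \<partial>\<^sub>d m\<^sub>b\<^sub>c)\<close> of a metric \<open>m\<close> with
  respect to a family of derivations.\<close>
definition christoffel ::
    "('n::finite point \<Rightarrow> real^'n^'n) \<Rightarrow> ('n \<Rightarrow> ('n point \<Rightarrow> real) \<Rightarrow> 'n point \<Rightarrow> real) \<Rightarrow> 'n coeffs" where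
  "christoffel m P a b c z = 1/2 * (\<Sum>d\<in>UNIV. matrix_inv (m z) $ a $ d *
     (P b (\<lambda>w. m w $ d $ c) z + P c (\<lambda>w. m w $ b $ d) z - P d (\<lambda>w. m w $ b $ c) z))"

definition spray_G :: "('n::finite point \<Rightarrow> real) \<Rightarrow> 'n \<Rightarrow> 'n point \<Rightarrow> real" where
  "spray_G F a z = 1/2 * (\<Sum>b\<in>UNIV. \<Sum>c\<in>UNIV.
     christoffel (metric_g F) d_x a b c z * snd z $ b * snd z $ c)"

definition cartan_N :: "('n::finite point \<Rightarrow> real) \<Rightarrow> 'n \<Rightarrow> 'n \<Rightarrow> 'n point \<Rightarrow> real" where
  "cartan_N F a b z = d_y b (spray_G F a) z"

definition delta_x ::
    "('n::finite point \<Rightarrow> real) \<Rightarrow> 'n \<Rightarrow> ('n point \<Rightarrow> real) \<Rightarrow> 'n point \<Rightarrow> real" where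
  "delta_x F a f z = d_x a f z - (\<Sum>b\<in>UNIV. cartan_N F b a z * d_y b f z)"

definition metric_h :: "real \<Rightarrow> ('n::finite point \<Rightarrow> real) \<Rightarrow> 'n point \<Rightarrow> real^'n^'n" where
  "metric_h p F z = (p\<^sup>2 / (\<Sum>a\<in>UNIV. \<Sum>b\<in>UNIV. metric_g F z $ a $ b * snd z $ a * snd z $ b))
     *\<^sub>R metric_g F z"

definition LH :: "('n::finite point \<Rightarrow> real) \<Rightarrow> 'n coeffs" where
  "LH F = christoffel (metric_g F) (delta_x F)"
definition LV :: "real \<Rightarrow> ('n::finite point \<Rightarrow> real) \<Rightarrow> 'n coeffs" where
  "LV p F = christoffel (metric_h p F) (delta_x F)"
definition CH :: "('n::finite point \<Rightarrow> real) \<Rightarrow> 'n coeffs" where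
  "CH F = christoffel (metric_g F) d_y"
definition CV :: "real \<Rightarrow> ('n::finite point \<Rightarrow> real) \<Rightarrow> 'n coeffs" where
  "CV p F = christoffel (metric_h p F) d_y"

definition form_dx :: "'n::finite \<Rightarrow> 'n form" where
  "form_dx a z \<zeta> = fst \<zeta> $ a"

definition form_delta_y :: "('n::finite point \<Rightarrow> real) \<Rightarrow> 'n \<Rightarrow> 'n form" where
  "form_delta_y F a z \<zeta> = snd \<zeta> $ a + (\<Sum>b\<in>UNIV. cartan_N F a b z * fst \<zeta> $ b)"

definition omega_H :: "('n::finite point \<Rightarrow> real) \<Rightarrow> 'n \<Rightarrow> 'n \<Rightarrow> 'n form" where
  "omega_H F a b z \<zeta> = (\<Sum>c\<in>UNIV. LH F a b c z * form_dx c z \<zeta>)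
     + (\<Sum>c\<in>UNIV. CH F a b c z * form_delta_y F c z \<zeta>)"

definition omega_V :: "real \<Rightarrow> ('n::finite point \<Rightarrow> real) \<Rightarrow> 'n \<Rightarrow> 'n \<Rightarrow> 'n form" where
  "omega_V p F a b z \<zeta> = (\<Sum>c\<in>UNIV. LV p F a b c z * form_dx c z \<zeta>)
     + (\<Sum>c\<in>UNIV. CV p F a b c z * form_delta_y F c z \<zeta>)"

definition finsler_space ::
    "('p::{t2_space,second_countable_topology}, 'n::finite) chart set \<Rightarrow> (('p, 'n) tvec \<Rightarrow> real) \<Rightarrow> bool" where
  "finsler_space A F \<longleftrightarrow> smooth_manifold A \<and>
     (\<forall>c\<in>A. let Fc = F \<circ> tangent_point A c in
        smooth_on Fc (chart_image c \<times> (UNIV - {0})) \<and>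
        continuous_on (chart_image c \<times> UNIV) Fc \<and>
        (\<forall>x\<in>chart_image c. \<forall>y. y \<noteq> 0 \<longrightarrow> Fc (x, y) > 0) \<and>
        (\<forall>x\<in>chart_image c. \<forall>y. \<forall>t>0. Fc (x, t *\<^sub>R y) = t * Fc (x, y)) \<and>
        (\<forall>x\<in>chart_image c. \<forall>y. y \<noteq> 0 \<longrightarrow>
           (\<forall>w. w \<noteq> 0 \<longrightarrow> w \<bullet> (metric_g Fc (x, y) *v w) > 0)))"

section \<open>Local geometry along the submanifold\<close>

text \<open>Here \<open>X\<close> is the local expression \<open>x = x(u)\<close> of the immersion, \<open>Bn\<close>, \<open>Bt\<close>, \<open>Bd\<close> stand for
  \<open>B\<^sup>a\<close> with a barred lower index, \<open>B\<^sub>a\<close> with an unbarred upper index and \<open>B\<^sub>a\<close> with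
  a barred upper index. Upper indices come first: \<open>Bt z $ \<alpha> $ a\<close>. The index type \<open>'k\<close> of the
  barred indices has \<open>n - m\<close> elements.\<close>

definition B1 :: "(real^'m \<Rightarrow> real^'n) \<Rightarrow> 'n::finite \<Rightarrow> 'm::finite \<Rightarrow> real^'m \<Rightarrow> real" where
  "B1 X a \<alpha> u = jacobian X (at u) $ a $ \<alpha>"

definition B2 :: "(real^'m \<Rightarrow> real^'n) \<Rightarrow> 'n::finite \<Rightarrow> 'm::finite \<Rightarrow> 'm \<Rightarrow> real^'m \<Rightarrow> real" where
  "B2 X a \<alpha> \<beta> u = frechet_derivative (B1 X a \<beta>) (at u) (axis \<alpha> 1)"

definition B0 :: "(real^'m \<Rightarrow> real^'n) \<Rightarrow> 'n::finite \<Rightarrow> 'm::finite \<Rightarrow> 'm point \<Rightarrow> real" where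
  "B0 X a \<beta> z = (\<Sum>\<alpha>\<in>UNIV. B2 X a \<alpha> \<beta> (fst z) * snd z $ \<alpha>)"

definition osc_map :: "(real^'m::finite \<Rightarrow> real^'n::finite) \<Rightarrow> 'm point \<Rightarrow> 'n point" where
  "osc_map X z = (X (fst z), \<chi> a. \<Sum>\<alpha>\<in>UNIV. B1 X a \<alpha> (fst z) * snd z $ \<alpha>)"

definition moving_frame ::
    "(real^'m::finite \<Rightarrow> real^'n::finite) \<Rightarrow> 'm point set \<Rightarrow> ('m point \<Rightarrow> real^'k^'n) \<Rightarrow>
     ('m point \<Rightarrow> real^'n^'m) \<Rightarrow> ('m point \<Rightarrow> real^'n^'k::finite) \<Rightarrow> bool" where
  "moving_frame X \<Omega> Bn Bt Bd \<longleftrightarrow> smooth_on Bn \<Omega> \<and> smooth_on Bt \<Omega> \<and> smooth_on Bd \<Omega> \<and>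
     (\<forall>z\<in>\<Omega>.
        (\<forall>\<alpha> \<beta>. (\<Sum>a\<in>UNIV. B1 X a \<beta> (fst z) * Bt z $ \<alpha> $ a) = (if \<alpha> = \<beta> then 1 else 0)) \<and>
        (\<forall>\<alpha> \<beta>. (\<Sum>a\<in>UNIV. B1 X a \<beta> (fst z) * Bd z $ \<alpha> $ a) = 0) \<and>
        (\<forall>\<alpha> \<beta>. (\<Sum>a\<in>UNIV. Bt z $ \<alpha> $ a * Bn z $ a $ \<beta>) = 0) \<and>
        (\<forall>\<alpha> \<beta>. (\<Sum>a\<in>UNIV. Bd z $ \<alpha> $ a * Bn z $ a $ \<beta>) = (if \<alpha> = \<beta> then 1 else 0)) \<and>
        (\<forall>a b. (\<Sum>\<alpha>\<in>UNIV. B1 X a \<alpha> (fst z) * Bt z $ \<alpha> $ b)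
             + (\<Sum>\<alpha>\<in>UNIV. Bn z $ a $ \<alpha> * Bd z $ \<alpha> $ b) = (if a = b then 1 else 0)))"

definition induced_N ::
    "('n::finite point \<Rightarrow> real) \<Rightarrow> (real^'m \<Rightarrow> real^'n) \<Rightarrow> ('m point \<Rightarrow> real^'n^'m) \<Rightarrow>
     'm::finite \<Rightarrow> 'm \<Rightarrow> 'm point \<Rightarrow> real" where
  "induced_N F X Bt \<alpha> \<beta> z = (\<Sum>a\<in>UNIV. Bt z $ \<alpha> $ a *
     (B0 X a \<beta> z + (\<Sum>b\<in>UNIV. cartan_N F a b (osc_map X z) * B1 X b \<beta> (fst z))))"

definition normal_K ::
    "('n::finite point \<Rightarrow> real) \<Rightarrow> (real^'m \<Rightarrow> real^'n) \<Rightarrow> ('m point \<Rightarrow> real^'n^'k) \<Rightarrow>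
     'k::finite \<Rightarrow> 'm::finite \<Rightarrow> 'm point \<Rightarrow> real" where
  "normal_K F X Bd \<kappa> \<beta> z = (\<Sum>a\<in>UNIV. Bd z $ \<kappa> $ a *
     (B0 X a \<beta> z + (\<Sum>b\<in>UNIV. cartan_N F a b (osc_map X z) * B1 X b \<beta> (fst z))))"

definition form_du :: "'m::finite \<Rightarrow> 'm form" where
  "form_du \<alpha> z \<zeta> = fst \<zeta> $ \<alpha>"

definition form_delta_v ::
    "('n::finite point \<Rightarrow> real) \<Rightarrow> (real^'m \<Rightarrow> real^'n) \<Rightarrow> ('m point \<Rightarrow> real^'n^'m) \<Rightarrow>
     'm::finite \<Rightarrow> 'm form" where
  "form_delta_v F X Bt \<alpha> z \<zeta> = snd \<zeta> $ \<alpha> + (\<Sum>\<beta>\<in>UNIV. induced_N F X Bt \<alpha> \<beta> z * fst \<zeta> $ \<beta>)"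

definition pullback :: "('m::finite point \<Rightarrow> 'n::finite point) \<Rightarrow> 'n form \<Rightarrow> 'm form" where
  "pullback \<Phi> \<omega> z \<zeta> = \<omega> (\<Phi> z) (frechet_derivative \<Phi> (at z) \<zeta>)"

definition omega_H_check ::
    "('n::finite point \<Rightarrow> real) \<Rightarrow> (real^'m::finite \<Rightarrow> real^'n) \<Rightarrow> 'n \<Rightarrow> 'n \<Rightarrow> 'm form" where
  "omega_H_check F X a b = pullback (osc_map X) (omega_H F a b)"

definition omega_V_check ::
    "real \<Rightarrow> ('n::finite point \<Rightarrow> real) \<Rightarrow> (real^'m::finite \<Rightarrow> real^'n) \<Rightarrow> 'n \<Rightarrow> 'n \<Rightarrow> 'm form" where
  "omega_V_check p F X a b = pullback (osc_map X) (omega_V p F a b)"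

text \<open>The operator \<open>Y\<^sup>a \<mapsto> dY\<^sup>a + \<omega>\<^sup>a\<^sub>b Y\<^sup>b\<close>.\<close>
definition covariant_differential ::
    "('n::finite \<Rightarrow> 'n \<Rightarrow> 'm::finite form) \<Rightarrow> ('m point \<Rightarrow> real^'n) \<Rightarrow> 'n \<Rightarrow> 'm form" where
  "covariant_differential \<omega> Y a z \<zeta> =
     frechet_derivative (\<lambda>w. Y w $ a) (at z) \<zeta> + (\<Sum>b\<in>UNIV. \<omega> a b z \<zeta> * Y z $ b)"

definition coupling_DH ::
    "('n::finite point \<Rightarrow> real) \<Rightarrow> (real^'m::finite \<Rightarrow> real^'n) \<Rightarrow> ('m point \<Rightarrow> real^'n) \<Rightarrow> 'n \<Rightarrow> 'm form" where
  "coupling_DH F X = covariant_differential (omega_H_check F X)"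

definition coupling_DV ::
    "real \<Rightarrow> ('n::finite point \<Rightarrow> real) \<Rightarrow> (real^'m::finite \<Rightarrow> real^'n) \<Rightarrow> ('m point \<Rightarrow> real^'n) \<Rightarrow> 'n \<Rightarrow> 'm form" where
  "coupling_DV p F X = covariant_differential (omega_V_check p F X)"

text \<open>The form \<open>L\<^sup>a\<^sub>b\<^sub>\<delta> du\<^sup>\<delta> + C\<^sup>a\<^sub>b\<^sub>\<delta> \<delta>v\<^sup>\<delta>\<close>.\<close>
definition form_of_coeffs ::
    "('n::finite point \<Rightarrow> real) \<Rightarrow> (real^'m::finite \<Rightarrow> real^'n) \<Rightarrow> ('m point \<Rightarrow> real^'n^'m) \<Rightarrow>
     ('n \<Rightarrow> 'n \<Rightarrow> 'm \<Rightarrow> 'm point \<Rightarrow> real) \<Rightarrow> ('n \<Rightarrow> 'n \<Rightarrow> 'm \<Rightarrow> 'm point \<Rightarrow> real) \<Rightarrow>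
     'n \<Rightarrow> 'n \<Rightarrow> 'm form" where
  "form_of_coeffs F X Bt L C a b z \<zeta> = (\<Sum>\<delta>\<in>UNIV. L a b \<delta> z * form_du \<delta> z \<zeta>)
     + (\<Sum>\<delta>\<in>UNIV. C a b \<delta> z * form_delta_v F X Bt \<delta> z \<zeta>)"

definition LH_check ::
    "('n::finite point \<Rightarrow> real) \<Rightarrow> (real^'m \<Rightarrow> real^'n) \<Rightarrow> ('m point \<Rightarrow> real^'k^'n) \<Rightarrow>
     ('m point \<Rightarrow> real^'n^'k::finite) \<Rightarrow> 'n \<Rightarrow> 'n \<Rightarrow> 'm::finite \<Rightarrow> 'm point \<Rightarrow> real" where
  "LH_check F X Bn Bd a b \<delta> z =
     (\<Sum>d\<in>UNIV. LH F a b d (osc_map X z) * B1 X d \<delta> (fst z))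
     + (\<Sum>d\<in>UNIV. \<Sum>\<kappa>\<in>UNIV. CH F a b d (osc_map X z) * Bn z $ d $ \<kappa> * normal_K F X Bd \<kappa> \<delta> z)"

definition LV_check ::
    "real \<Rightarrow> ('n::finite point \<Rightarrow> real) \<Rightarrow> (real^'m \<Rightarrow> real^'n) \<Rightarrow> ('m point \<Rightarrow> real^'k^'n) \<Rightarrow>
     ('m point \<Rightarrow> real^'n^'k::finite) \<Rightarrow> 'n \<Rightarrow> 'n \<Rightarrow> 'm::finite \<Rightarrow> 'm point \<Rightarrow> real" where
  "LV_check p F X Bn Bd a b \<delta> z =
     (\<Sum>d\<in>UNIV. LV p F a b d (osc_map X z) * B1 X d \<delta> (fst z))
     + (\<Sum>d\<in>UNIV. \<Sum>\<kappa>\<in>UNIV. CV p F a b d (osc_map X z) * Bn z $ d $ \<kappa> * normal_K F X Bd \<kappa> \<delta> z)"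

definition CH_check ::
    "('n::finite point \<Rightarrow> real) \<Rightarrow> (real^'m \<Rightarrow> real^'n) \<Rightarrow>
     'n \<Rightarrow> 'n \<Rightarrow> 'm::finite \<Rightarrow> 'm point \<Rightarrow> real" where
  "CH_check F X a b \<delta> z = (\<Sum>d\<in>UNIV. CH F a b d (osc_map X z) * B1 X d \<delta> (fst z))"

definition CV_check ::
    "real \<Rightarrow> ('n::finite point \<Rightarrow> real) \<Rightarrow> (real^'m \<Rightarrow> real^'n) \<Rightarrow>
     'n \<Rightarrow> 'n \<Rightarrow> 'm::finite \<Rightarrow> 'm point \<Rightarrow> real" where
  "CV_check p F X a b \<delta> z = (\<Sum>d\<in>UNIV. CV p F a b d (osc_map X z) * B1 X d \<delta> (fst z))"

end

theory Submission
  imports Defs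
begin

text \<open>By the frame identity \<open>B\<^sup>a\<^sub>\<alpha> B\<^sup>\<alpha>\<^sub>b + B\<^sup>a\<^sub>\<kappa> B\<^sup>\<kappa>\<^sub>b = \<delta>\<^sup>a\<^sub>b\<close>, the \<open>du\<close>-coefficient
  \<open>B\<^sup>a\<^sub>0\<^sub>\<beta> + N\<^sup>a\<^sub>b B\<^sup>b\<^sub>\<beta>\<close> of the restriction of \<open>\<delta>y\<^sup>a\<close> splits into a tangential part, which completes
  \<open>dv\<close> to \<open>\<delta>v\<close>, and a normal part: \<open>\<delta>y\<^sup>a\<close> restricts to \<open>B\<^sup>a\<^sub>\<kappa> K\<^sup>\<kappa>\<^sub>\<delta> du\<^sup>\<delta> + B\<^sup>a\<^sub>\<delta> \<delta>v\<^sup>\<delta>\<close>, while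
  \<open>dx\<^sup>a\<close> restricts to \<open>B\<^sup>a\<^sub>\<delta> du\<^sup>\<delta>\<close>. Substituting into \<open>\<omega>\<^sup>H\<close> and \<open>\<omega>\<^sup>V\<close> gives the coefficients.
  The analytic input is the symmetry of the second derivatives of the immersion: \<open>d(B\<^sup>a\<^sub>\<alpha> v\<^sup>\<alpha>)\<close>
  produces \<open>\<partial>\<^sub>\<beta> B\<^sup>a\<^sub>\<alpha> v\<^sup>\<alpha>\<close>, whereas \<open>B\<^sup>a\<^sub>0\<^sub>\<beta>\<close> is \<open>\<partial>\<^sub>\<alpha> B\<^sup>a\<^sub>\<beta> v\<^sup>\<alpha>\<close>.\<close>

section \<open>Symmetry of second derivatives\<close>

text \<open>The mean value theorem is applied twice, first along \<open>a\<close> and then along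
  \<open>b\<close>; each application contributes one factor \<open>h\<close>.\<close>

lemma second_difference_mean_value:
  fixes f :: "'a::real_normed_vector \<Rightarrow> real"
  assumes f: "\<And>y. y \<in> ball x r \<Longrightarrow> (f has_derivative f' y) (at y)"
    and A: "\<And>y. y \<in> ball x r \<Longrightarrow> ((\<lambda>y. f' y a) has_derivative A y) (at y)"
    and h: "0 < h" "h * (norm a + norm b) < r"
  obtains y where "dist x y \<le> h * (norm a + norm b)"
    and "f (x + h *\<^sub>R a + h *\<^sub>R b) - f (x + h *\<^sub>R a) - f (x + h *\<^sub>R b) + f x = h\<^sup>2 * A y b"
proof -
  \<comment> \<open>The whole parallelogram spanned by \<open>h *\<^sub>R a\<close> and
    \<open>h *\<^sub>R b\<close> stays inside the ball, so both derivatives are available along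
    every segment used below.\<close>
  have near: "dist x (x + s *\<^sub>R a + t *\<^sub>R b) \<le> h * (norm a + norm b)"
    if "0 \<le> s" "s \<le> h" "0 \<le> t" "t \<le> h" for s t
  proof -
    have "dist x (x + s *\<^sub>R a + t *\<^sub>R b) = norm (s *\<^sub>R a + t *\<^sub>R b)"
      by (simp add: dist_norm norm_minus_commute algebra_simps)
    also have "\<dots> \<le> s * norm a + t * norm b"
      using that by (intro norm_triangle_le) simp
    also have "\<dots> \<le> h * (norm a + norm b)"
      using that by (simp add: distrib_left add_mono mult_right_mono)
    finally show ?thesis .
  qed
  hence inb: "x + s *\<^sub>R a + t *\<^sub>R b \<in> ball x r"
    if "0 \<le> s" "s \<le> h" "0 \<le> t" "t \<le> h" for s t
    using that h(2) by (meson le_less_trans mem_ball)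
  have f_line: "((\<lambda>s. f (x + s *\<^sub>R a + t *\<^sub>R b)) has_real_derivative f' (x + s *\<^sub>R a + t *\<^sub>R b) a) (at s)"
    if "0 \<le> s" "s \<le> h" "0 \<le> t" "t \<le> h" for s t
  proof -
    have D: "(f has_derivative f' (x + s *\<^sub>R a + t *\<^sub>R b)) (at (x + s *\<^sub>R a + t *\<^sub>R b))"
      using f inb that by blast
    have "((\<lambda>s. f (x + s *\<^sub>R a + t *\<^sub>R b)) has_derivative (\<lambda>k. f' (x + s *\<^sub>R a + t *\<^sub>R b) (k *\<^sub>R a))) (at s)"
      by (rule has_derivative_compose[where g = f and f = "\<lambda>s. x + s *\<^sub>R a + t *\<^sub>R b", OF _ D]) (auto intro!: derivative_eq_intros)
    moreover have "f' (x + s *\<^sub>R a + t *\<^sub>R b) (k *\<^sub>R a) = k * f' (x + s *\<^sub>R a + t *\<^sub>R b) a" for k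
      using has_derivative_linear[OF D] by (simp add: linear_scale)
    ultimately show ?thesis
      by (simp add: has_field_derivative_def mult_commute_abs)
  qed
  \<comment> \<open>Mean value theorem for the difference of the two edge functions in
    \<open>s\<close>, at \<open>t = h\<close> and \<open>t = 0\<close>. The zero multiples keep the
    terms in the shape of \<open>f_line\<close>.\<close>
  have "\<exists>s. 0 < s \<and> s < h \<and>
      (f (x + h *\<^sub>R a + h *\<^sub>R b) - f (x + h *\<^sub>R a + 0 *\<^sub>R b)) - (f (x + 0 *\<^sub>R a + h *\<^sub>R b) - f (x + 0 *\<^sub>R a + 0 *\<^sub>R b)) =
      (h - 0) * (f' (x + s *\<^sub>R a + h *\<^sub>R b) a - f' (x + s *\<^sub>R a + 0 *\<^sub>R b) a)"
    using h(1) by (intro MVT2 DERIV_diff f_line) auto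
  then obtain s where s: "0 < s" "s < h" and
    eq1: "f (x + h *\<^sub>R a + h *\<^sub>R b) - f (x + h *\<^sub>R a) - f (x + h *\<^sub>R b) + f x =
      h * (f' (x + s *\<^sub>R a + h *\<^sub>R b) a - f' (x + s *\<^sub>R a + 0 *\<^sub>R b) a)"
    by auto
  have A_line: "((\<lambda>t. f' (x + s *\<^sub>R a + t *\<^sub>R b) a) has_real_derivative A (x + s *\<^sub>R a + t *\<^sub>R b) b) (at t)"
    if "0 \<le> t" "t \<le> h" for t
  proof -
    have D: "((\<lambda>y. f' y a) has_derivative A (x + s *\<^sub>R a + t *\<^sub>R b)) (at (x + s *\<^sub>R a + t *\<^sub>R b))"
      using A inb that s by simp
    have "((\<lambda>t. f' (x + s *\<^sub>R a + t *\<^sub>R b) a) has_derivative (\<lambda>k. A (x + s *\<^sub>R a + t *\<^sub>R b) (k *\<^sub>R b))) (at t)"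
      by (rule has_derivative_compose[where g = "\<lambda>y. f' y a" and f = "\<lambda>t. x + s *\<^sub>R a + t *\<^sub>R b", OF _ D]) (auto intro!: derivative_eq_intros)
    moreover have "A (x + s *\<^sub>R a + t *\<^sub>R b) (k *\<^sub>R b) = k * A (x + s *\<^sub>R a + t *\<^sub>R b) b" for k
      using has_derivative_linear[OF D] by (simp add: linear_scale)
    ultimately show ?thesis
      by (simp add: has_field_derivative_def mult_commute_abs)
  qed
  obtain t where t: "0 < t" "t < h" and
    eq2: "f' (x + s *\<^sub>R a + h *\<^sub>R b) a - f' (x + s *\<^sub>R a + 0 *\<^sub>R b) a = (h - 0) * A (x + s *\<^sub>R a + t *\<^sub>R b) b"
    using MVT2[OF h(1) A_line] by blast
  show thesis
    using near[of s t] s t eq1 eq2 by (intro that[of "x + s *\<^sub>R a + t *\<^sub>R b"]) (simp_all add: power2_eq_square)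
qed

text \<open>The second difference is symmetric in \<open>a\<close> and \<open>b\<close>. Divided by
  \<open>h\<^sup>2\<close> it is a value of both second derivatives at points near \<open>x\<close>,
  so continuity at \<open>x\<close> excludes a gap between them.\<close>

lemma second_derivative_symmetric:
  fixes f :: "'a::real_normed_vector \<Rightarrow> real"
  assumes "open S" "x \<in> S"
    and f: "\<And>y. y \<in> S \<Longrightarrow> (f has_derivative f' y) (at y)"
    and A: "\<And>y. y \<in> S \<Longrightarrow> ((\<lambda>y. f' y a) has_derivative A y) (at y)"
    and B: "\<And>y. y \<in> S \<Longrightarrow> ((\<lambda>y. f' y b) has_derivative B y) (at y)"
    and "isCont (\<lambda>y. A y b) x" "isCont (\<lambda>y. B y a) x"
  shows "A x b = B x a"
proof (rule ccontr)
  assume ne: "A x b \<noteq> B x a"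
  \<comment> \<open>Half the gap: no number is within \<open>e\<close> of both values.\<close>
  define e where "e = dist (A x b) (B x a) / 2"
  have "e > 0" using ne by (simp add: e_def)
  obtain r where r: "r > 0" "ball x r \<subseteq> S"
    using assms(1,2) open_contains_ball by blast
  obtain d1 where d1: "d1 > 0" "\<And>y. dist y x < d1 \<Longrightarrow> dist (A y b) (A x b) < e"
    using assms(6) \<open>e > 0\<close> unfolding continuous_at_eps_delta by blast
  obtain d2 where d2: "d2 > 0" "\<And>y. dist y x < d2 \<Longrightarrow> dist (B y a) (B x a) < e"
    using assms(7) \<open>e > 0\<close> unfolding continuous_at_eps_delta by blast
  define m where "m = min r (min d1 d2)"
  \<comment> \<open>The summand 1 keeps the denominator positive even for \<open>a = b = 0\<close>
    and makes \<open>h * (norm a + norm b) < m\<close> strict.\<close>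
  define h where "h = m / (norm a + norm b + 1)"
  have "m > 0" using r d1 d2 by (simp add: m_def)
  have nn: "norm a + norm b + 1 > 0"
    by (simp add: add_nonneg_pos)
  have h: "h > 0" "h * (norm a + norm b) < m"
    using \<open>m > 0\<close> nn by (auto simp: h_def field_simps)
  have hr: "h * (norm a + norm b) < r" "h * (norm b + norm a) < r"
    using h by (auto simp: m_def add.commute)
  obtain y where y: "dist x y \<le> h * (norm a + norm b)"
    "f (x + h *\<^sub>R a + h *\<^sub>R b) - f (x + h *\<^sub>R a) - f (x + h *\<^sub>R b) + f x = h\<^sup>2 * A y b"
    using second_difference_mean_value[of x r f f' a A h b] f A r h(1) hr by blast
  obtain y' where y': "dist x y' \<le> h * (norm b + norm a)"
    "f (x + h *\<^sub>R b + h *\<^sub>R a) - f (x + h *\<^sub>R b) - f (x + h *\<^sub>R a) + f x = h\<^sup>2 * B y' a"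
    using second_difference_mean_value[of x r f f' b B h a] f B r h(1) hr by blast
  have comm: "x + h *\<^sub>R b + h *\<^sub>R a = x + h *\<^sub>R a + h *\<^sub>R b" by simp
  have "h\<^sup>2 * A y b = h\<^sup>2 * B y' a"
    using y(2) y'(2)[unfolded comm] by linarith
  hence eq: "B y' a = A y b" using h(1) by simp
  have "dist (A y b) (A x b) < e"
    using y(1) h(2) by (intro d1(2)) (simp add: m_def dist_commute)
  moreover have "dist (B y' a) (B x a) < e"
    using y'(1) h(2) by (intro d2(2)) (simp add: m_def dist_commute add.commute)
  ultimately show False
    unfolding eq e_def by (blast dest: dist_triangle_half_r)
qed

section \<open>Second-order calculus of the immersion\<close>

lemma smooth_on_imp_C2:
  assumes "smooth_on f S" "x \<in> S"
  shows "f differentiable (at x)"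
    and "(\<lambda>y. frechet_derivative f (at y) v) differentiable (at x)"
    and "continuous_on S (\<lambda>y. frechet_derivative (\<lambda>y. frechet_derivative f (at y) v) (at y) w)"
proof -
  have "Ck_on (Suc (Suc 0)) f S"
    using assms(1) unfolding smooth_on_def by blast
  then show "f differentiable (at x)"
    and "(\<lambda>y. frechet_derivative f (at y) v) differentiable (at x)"
    and "continuous_on S (\<lambda>y. frechet_derivative (\<lambda>y. frechet_derivative f (at y) v) (at y) w)"
    using assms(2) by simp_all
qed

lemma B1_eq: "B1 X a \<alpha> u = frechet_derivative X (at u) (axis \<alpha> 1) $ a"
  by (simp add: B1_def jacobian_def matrix_def)

lemma frechet_derivative_eq_B1:
  fixes X :: "real^'m::finite \<Rightarrow> real^'n::finite"
  assumes "X differentiable (at u)"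
  shows "frechet_derivative X (at u) \<xi> $ a = (\<Sum>\<beta>\<in>UNIV. B1 X a \<beta> u * \<xi> $ \<beta>)"
  using frechet_derivative_at[OF jacobian_works[THEN iffD1, OF assms], symmetric]
  by (simp add: B1_def matrix_vector_mult_def)

lemma has_derivative_B1:
  fixes X :: "real^'m::finite \<Rightarrow> real^'n::finite"
  assumes "smooth_on X S" "u \<in> S"
  shows "(B1 X a \<alpha> has_derivative
    (\<lambda>\<xi>. frechet_derivative (\<lambda>y. frechet_derivative X (at y) (axis \<alpha> 1)) (at u) \<xi> $ a)) (at u)"
proof -
  have "((\<lambda>y. frechet_derivative X (at y) (axis \<alpha> 1)) has_derivative
      frechet_derivative (\<lambda>y. frechet_derivative X (at y) (axis \<alpha> 1)) (at u)) (at u)"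
    using smooth_on_imp_C2(2)[OF assms] frechet_derivative_works by blast
  from bounded_linear.has_derivative[OF bounded_linear_vec_nth[of a] this]
  show ?thesis
    by (simp add: B1_eq[abs_def])
qed

lemma B2_eq:
  fixes X :: "real^'m::finite \<Rightarrow> real^'n::finite"
  assumes "smooth_on X S" "u \<in> S"
  shows "B2 X a \<alpha> \<beta> u =
    frechet_derivative (\<lambda>y. frechet_derivative X (at y) (axis \<beta> 1)) (at u) (axis \<alpha> 1) $ a"
  using frechet_derivative_at[OF has_derivative_B1[OF assms, of a \<beta>]]
  unfolding B2_def by metis

text \<open>This is the symmetry of second derivatives for the component \<open>a\<close> of
  \<open>X\<close> along two coordinate axes; the required continuity is the second-order level of
  smoothness.\<close>

lemma B2_symmetric:
  fixes X :: "real^'m::finite \<Rightarrow> real^'n::finite"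
  assumes "open S" "smooth_on X S" "u \<in> S"
  shows "B2 X a \<alpha> \<beta> u = B2 X a \<beta> \<alpha> u"
proof -
  have D: "((\<lambda>y. X y $ a) has_derivative (\<lambda>\<xi>. frechet_derivative X (at y) \<xi> $ a)) (at y)"
    if "y \<in> S" for y
    using smooth_on_imp_C2(1)[OF assms(2) that] frechet_derivative_works
    by (blast intro: bounded_linear.has_derivative[OF bounded_linear_vec_nth])
  have D2: "((\<lambda>y. frechet_derivative X (at y) (axis \<gamma> 1) $ a) has_derivative
     (\<lambda>\<xi>. frechet_derivative (\<lambda>y. frechet_derivative X (at y) (axis \<gamma> 1)) (at y) \<xi> $ a)) (at y)"
    if "y \<in> S" for y \<gamma>
    using has_derivative_B1[OF assms(2) that, of a \<gamma>] by (simp add: B1_eq[abs_def])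
  have cont: "isCont (\<lambda>y. frechet_derivative (\<lambda>y. frechet_derivative X (at y) v) (at y) w $ a) u" for v w
    using smooth_on_imp_C2(3)[OF assms(2,3)] assms(1,3)
    by (intro isCont_vec_nth) (simp add: continuous_on_eq_continuous_at)
  show ?thesis
    unfolding B2_eq[OF assms(2,3)]
    by (rule second_derivative_symmetric[OF assms(1,3) D D2 D2 cont cont])
qed

text \<open>Linearity reduces an arbitrary direction to the coordinate axes. The direction of
  differentiation is the first lower index of \<open>B2\<close>, so contracting
  \<open>\<alpha>\<close> with \<open>v\<close> does not literally give \<open>B0\<close>, where the
  roles of the two indices are exchanged.\<close>

lemma has_derivative_B1_B2:
  fixes X :: "real^'m::finite \<Rightarrow> real^'n::finite"
  assumes "smooth_on X S" "u \<in> S"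
  shows "(B1 X a \<alpha> has_derivative (\<lambda>\<xi>. \<Sum>\<beta>\<in>UNIV. B2 X a \<beta> \<alpha> u * \<xi> $ \<beta>)) (at u)"
proof -
  let ?D = "\<lambda>\<xi>. frechet_derivative (\<lambda>y. frechet_derivative X (at y) (axis \<alpha> 1)) (at u) \<xi> $ a"
  have D: "(B1 X a \<alpha> has_derivative ?D) (at u)"
    by (rule has_derivative_B1[OF assms])
  have "?D \<xi> = (\<Sum>\<beta>\<in>UNIV. B2 X a \<beta> \<alpha> u * \<xi> $ \<beta>)" for \<xi>
  proof -
    interpret linear ?D using D by (rule has_derivative_linear)
    have "?D \<xi> = ?D (\<Sum>\<beta>\<in>UNIV. \<xi> $ \<beta> *\<^sub>R axis \<beta> 1)"
      using basis_expansion[of \<xi>] by (simp add: scalar_mult_eq_scaleR)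
    also have "\<dots> = (\<Sum>\<beta>\<in>UNIV. \<xi> $ \<beta> * ?D (axis \<beta> 1))"
      unfolding sum scale by simp
    finally show ?thesis
      by (simp add: B2_eq[OF assms] mult.commute)
  qed
  then show ?thesis using D by presburger
qed

section \<open>Differential of the induced map of tangent bundles\<close>

lemma has_derivative_vec_lambda:
  fixes f :: "'n::finite \<Rightarrow> 'a::real_normed_vector \<Rightarrow> real"
  assumes "\<And>i. (f i has_derivative f' i) (at x)"
  shows "((\<lambda>y. \<chi> i. f i y) has_derivative (\<lambda>\<xi>. \<chi> i. f' i \<xi>)) (at x)"
proof -
  have vec_eq: "(\<chi> i. v i) = (\<Sum>i\<in>UNIV. v i *\<^sub>R axis i 1)" for v :: "'n \<Rightarrow> real"
    by (simp add: vec_eq_iff axis_def if_distrib cong: if_cong)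
  show ?thesis
    unfolding vec_eq by (intro derivative_intros assms)
qed

text \<open>The base part is the chain rule; the fibre part is the product rule for
  \<open>B1\<close> times \<open>v\<close>.\<close>

lemma frechet_derivative_osc_map:
  fixes X :: "real^'m::finite \<Rightarrow> real^'n::finite"
  assumes "open S" "smooth_on X S" "fst z \<in> S"
  shows "frechet_derivative (osc_map X) (at z) \<zeta> =
    (\<chi> a. \<Sum>\<beta>\<in>UNIV. B1 X a \<beta> (fst z) * fst \<zeta> $ \<beta>,
     \<chi> a. (\<Sum>\<beta>\<in>UNIV. B0 X a \<beta> z * fst \<zeta> $ \<beta>) + (\<Sum>\<alpha>\<in>UNIV. B1 X a \<alpha> (fst z) * snd \<zeta> $ \<alpha>))"
proof -
  have X: "X differentiable (at (fst z))"
    using smooth_on_imp_C2(1)[OF assms(2,3)] .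
  have base: "((\<lambda>w. X (fst w)) has_derivative (\<lambda>\<zeta>. frechet_derivative X (at (fst z)) (fst \<zeta>))) (at z)"
    by (rule has_derivative_compose[where g = X])
      (auto intro!: derivative_eq_intros simp: X frechet_derivative_works[symmetric])
  have B: "((\<lambda>w. B1 X a \<alpha> (fst w)) has_derivative
      (\<lambda>\<zeta>. \<Sum>\<beta>\<in>UNIV. B2 X a \<beta> \<alpha> (fst z) * fst \<zeta> $ \<beta>)) (at z)" for a \<alpha>
    by (rule has_derivative_compose[where g = "B1 X a \<alpha>" and f = fst, OF _ has_derivative_B1_B2[OF assms(2,3)]])
      (auto intro!: derivative_eq_intros)
  have v: "((\<lambda>w. snd w $ \<alpha>) has_derivative (\<lambda>\<zeta>. snd \<zeta> $ \<alpha>)) (at z)"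
    for \<alpha> and z :: "'m point"
    by (intro bounded_linear.has_derivative[OF bounded_linear_vec_nth] derivative_intros)
  have fibre: "((\<lambda>w. \<chi> a. \<Sum>\<alpha>\<in>UNIV. B1 X a \<alpha> (fst w) * snd w $ \<alpha>) has_derivative
      (\<lambda>\<zeta>. \<chi> a. \<Sum>\<alpha>\<in>UNIV. B1 X a \<alpha> (fst z) * snd \<zeta> $ \<alpha> +
         (\<Sum>\<beta>\<in>UNIV. B2 X a \<beta> \<alpha> (fst z) * fst \<zeta> $ \<beta>) * snd z $ \<alpha>)) (at z)"
    by (intro has_derivative_vec_lambda has_derivative_sum has_derivative_mult B v)
  \<comment> \<open>The symmetry of \<open>B2\<close> enters here: the product rule contracts
    \<open>v\<close> with the index of the differentiated \<open>B1\<close>, whereas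
    \<open>B0\<close> contracts it with the direction of differentiation.\<close>
  have swap: "(\<Sum>\<alpha>\<in>UNIV. (\<Sum>\<beta>\<in>UNIV. B2 X a \<beta> \<alpha> (fst z) * fst \<zeta> $ \<beta>) * snd z $ \<alpha>) =
      (\<Sum>\<beta>\<in>UNIV. B0 X a \<beta> z * fst \<zeta> $ \<beta>)" for a
    unfolding B0_def sum_distrib_right
    by (subst sum.swap) (simp add: B2_symmetric[OF assms, of a] mult_ac)
  have "(osc_map X has_derivative
     (\<lambda>\<zeta>. (frechet_derivative X (at (fst z)) (fst \<zeta>),
       \<chi> a. \<Sum>\<alpha>\<in>UNIV. B1 X a \<alpha> (fst z) * snd \<zeta> $ \<alpha> +
         (\<Sum>\<beta>\<in>UNIV. B2 X a \<beta> \<alpha> (fst z) * fst \<zeta> $ \<beta>) * snd z $ \<alpha>))) (at z)"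
    using has_derivative_Pair[OF base fibre] by (simp add: osc_map_def[abs_def])
  from frechet_derivative_at[OF this, symmetric] show ?thesis
    by (simp add: vec_eq_iff frechet_derivative_eq_B1[OF X] sum.distrib swap)
qed

section \<open>Restriction of the ambient cobasis and of the connection forms\<close>

lemma form_dx_pullback:
  fixes X :: "real^'m::finite \<Rightarrow> real^'n::finite"
  assumes "open S" "smooth_on X S" "fst z \<in> S"
  shows "pullback (osc_map X) (form_dx a) z \<zeta> = (\<Sum>\<delta>\<in>UNIV. B1 X a \<delta> (fst z) * form_du \<delta> z \<zeta>)"
  by (simp add: pullback_def form_dx_def form_du_def frechet_derivative_osc_map[OF assms])

lemma form_delta_y_pullback:
  fixes X :: "real^'m::finite \<Rightarrow> real^'n::finite" and Bn :: "'m point \<Rightarrow> real^'k::finite^'n"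
  assumes "open S" "smooth_on X S" "fst z \<in> S" and "moving_frame X \<Omega> Bn Bt Bd" "z \<in> \<Omega>"
  shows "pullback (osc_map X) (form_delta_y F a) z \<zeta> =
    (\<Sum>\<delta>\<in>UNIV. (\<Sum>\<kappa>\<in>UNIV. Bn z $ a $ \<kappa> * normal_K F X Bd \<kappa> \<delta> z) * form_du \<delta> z \<zeta>) +
    (\<Sum>\<delta>\<in>UNIV. B1 X a \<delta> (fst z) * form_delta_v F X Bt \<delta> z \<zeta>)"
proof -
  \<comment> \<open>\<open>V a \<beta>\<close> is the \<open>du\<close> coefficient of the
    restricted form; its contractions with \<open>Bt\<close> and \<open>Bd\<close> are by definition
    \<open>induced_N\<close> and \<open>normal_K\<close>.\<close>
  define V where "V a \<beta> = B0 X a \<beta> z + (\<Sum>b\<in>UNIV. cartan_N F a b (osc_map X z) * B1 X b \<beta> (fst z))" for a \<beta>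
  have frame: "(\<Sum>\<alpha>\<in>UNIV. B1 X a \<alpha> (fst z) * Bt z $ \<alpha> $ b) + (\<Sum>\<kappa>\<in>UNIV. Bn z $ a $ \<kappa> * Bd z $ \<kappa> $ b)
      = (if a = b then 1 else 0)" for b
    using assms(4,5) unfolding moving_frame_def by blast
  have split: "V a \<beta> = (\<Sum>\<alpha>\<in>UNIV. B1 X a \<alpha> (fst z) * induced_N F X Bt \<alpha> \<beta> z) +
      (\<Sum>\<kappa>\<in>UNIV. Bn z $ a $ \<kappa> * normal_K F X Bd \<kappa> \<beta> z)" for \<beta>
  proof -
    \<comment> \<open>A Kronecker delta is inserted so that the completeness relation
      \<open>frame\<close> can replace it by the tangential and normal projections.\<close>
    have "V a \<beta> = (\<Sum>b\<in>UNIV. (if a = b then 1 else 0) * V b \<beta>)"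
      by (simp add: if_distrib[of "\<lambda>t. t * _"] cong: if_cong)
    also have "\<dots> = (\<Sum>b\<in>UNIV. \<Sum>\<alpha>\<in>UNIV. B1 X a \<alpha> (fst z) * (Bt z $ \<alpha> $ b * V b \<beta>)) +
        (\<Sum>b\<in>UNIV. \<Sum>\<kappa>\<in>UNIV. Bn z $ a $ \<kappa> * (Bd z $ \<kappa> $ b * V b \<beta>))"
      unfolding frame[symmetric] by (simp add: distrib_right sum.distrib sum_distrib_right mult.assoc)
    also have "\<dots> = (\<Sum>\<alpha>\<in>UNIV. B1 X a \<alpha> (fst z) * induced_N F X Bt \<alpha> \<beta> z) +
        (\<Sum>\<kappa>\<in>UNIV. Bn z $ a $ \<kappa> * normal_K F X Bd \<kappa> \<beta> z)"
      unfolding induced_N_def normal_K_def V_def[symmetric] sum_distrib_left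
      by (intro arg_cong2[where f = "(+)"] sum.swap)
    finally show ?thesis .
  qed
  have N: "(\<Sum>b\<in>UNIV. cartan_N F a b (osc_map X z) * (\<Sum>\<beta>\<in>UNIV. B1 X b \<beta> (fst z) * fst \<zeta> $ \<beta>)) =
      (\<Sum>\<beta>\<in>UNIV. (\<Sum>b\<in>UNIV. cartan_N F a b (osc_map X z) * B1 X b \<beta> (fst z)) * fst \<zeta> $ \<beta>)"
    unfolding sum_distrib_left sum_distrib_right by (subst sum.swap) (simp add: mult_ac)
  have "pullback (osc_map X) (form_delta_y F a) z \<zeta> =
      (\<Sum>\<beta>\<in>UNIV. V a \<beta> * fst \<zeta> $ \<beta>) + (\<Sum>\<alpha>\<in>UNIV. B1 X a \<alpha> (fst z) * snd \<zeta> $ \<alpha>)"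
    by (simp add: pullback_def form_delta_y_def frechet_derivative_osc_map[OF assms(1-3)] N V_def
        distrib_right sum.distrib)
  \<comment> \<open>The tangential part is regrouped with \<open>B1\<close> in front, so that it
    merges with the \<open>snd \<zeta>\<close> term into \<open>form_delta_v\<close>.\<close>
  also have "(\<Sum>\<beta>\<in>UNIV. V a \<beta> * fst \<zeta> $ \<beta>) =
      (\<Sum>\<beta>\<in>UNIV. (\<Sum>\<kappa>\<in>UNIV. Bn z $ a $ \<kappa> * normal_K F X Bd \<kappa> \<beta> z) * fst \<zeta> $ \<beta>) +
      (\<Sum>\<alpha>\<in>UNIV. B1 X a \<alpha> (fst z) * (\<Sum>\<beta>\<in>UNIV. induced_N F X Bt \<alpha> \<beta> z * fst \<zeta> $ \<beta>))"
  proof -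
    have "(\<Sum>\<beta>\<in>UNIV. (\<Sum>\<alpha>\<in>UNIV. B1 X a \<alpha> (fst z) * induced_N F X Bt \<alpha> \<beta> z) * fst \<zeta> $ \<beta>) =
        (\<Sum>\<alpha>\<in>UNIV. B1 X a \<alpha> (fst z) * (\<Sum>\<beta>\<in>UNIV. induced_N F X Bt \<alpha> \<beta> z * fst \<zeta> $ \<beta>))"
      unfolding sum_distrib_left sum_distrib_right by (subst sum.swap) (simp add: mult_ac)
    then show ?thesis
      by (simp add: split distrib_right sum.distrib)
  qed
  finally show ?thesis
    by (simp add: form_du_def form_delta_v_def distrib_left sum.distrib)
qed

text \<open>Only the expansion of a form in the ambient cobasis matters, so a single computation
  with arbitrary coefficients \<open>L\<close> and \<open>C\<close> serves both connection
  forms.\<close>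

lemma pullback_connection_form:
  fixes X :: "real^'m::finite \<Rightarrow> real^'n::finite" and Bn :: "'m point \<Rightarrow> real^'k::finite^'n"
  assumes "open S" "smooth_on X S" "fst z \<in> S" and "moving_frame X \<Omega> Bn Bt Bd" "z \<in> \<Omega>"
    and \<omega>: "\<And>w \<eta>. \<omega> w \<eta> = (\<Sum>d\<in>UNIV. L d w * form_dx d w \<eta>) + (\<Sum>d\<in>UNIV. C d w * form_delta_y F d w \<eta>)"
  shows "pullback (osc_map X) \<omega> z \<zeta> =
    (\<Sum>\<delta>\<in>UNIV. ((\<Sum>d\<in>UNIV. L d (osc_map X z) * B1 X d \<delta> (fst z)) +
        (\<Sum>d\<in>UNIV. \<Sum>\<kappa>\<in>UNIV. C d (osc_map X z) * Bn z $ d $ \<kappa> * normal_K F X Bd \<kappa> \<delta> z)) * form_du \<delta> z \<zeta>) +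
    (\<Sum>\<delta>\<in>UNIV. (\<Sum>d\<in>UNIV. C d (osc_map X z) * B1 X d \<delta> (fst z)) * form_delta_v F X Bt \<delta> z \<zeta>)"
proof -
  have swap: "(\<Sum>d\<in>UNIV. l d * (\<Sum>\<delta>\<in>UNIV. M d \<delta> * f \<delta>)) = (\<Sum>\<delta>\<in>UNIV. (\<Sum>d\<in>UNIV. l d * M d \<delta>) * f \<delta>)"
    for l :: "'n \<Rightarrow> real" and M and f :: "'m \<Rightarrow> real"
    unfolding sum_distrib_left sum_distrib_right by (subst sum.swap) (simp add: mult_ac)
  have "pullback (osc_map X) \<omega> z \<zeta> =
      (\<Sum>d\<in>UNIV. L d (osc_map X z) * pullback (osc_map X) (form_dx d) z \<zeta>) +
      (\<Sum>d\<in>UNIV. C d (osc_map X z) * pullback (osc_map X) (form_delta_y F d) z \<zeta>)"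
    by (simp add: pullback_def \<omega>)
  also have "\<dots> = (\<Sum>\<delta>\<in>UNIV. (\<Sum>d\<in>UNIV. L d (osc_map X z) * B1 X d \<delta> (fst z)) * form_du \<delta> z \<zeta>) +
      ((\<Sum>\<delta>\<in>UNIV. (\<Sum>d\<in>UNIV. C d (osc_map X z) *
          (\<Sum>\<kappa>\<in>UNIV. Bn z $ d $ \<kappa> * normal_K F X Bd \<kappa> \<delta> z)) * form_du \<delta> z \<zeta>) +
       (\<Sum>\<delta>\<in>UNIV. (\<Sum>d\<in>UNIV. C d (osc_map X z) * B1 X d \<delta> (fst z)) * form_delta_v F X Bt \<delta> z \<zeta>))"
    unfolding form_dx_pullback[OF assms(1-3)] form_delta_y_pullback[OF assms(1-5)]
    by (simp only: distrib_left sum.distrib swap)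
  finally show ?thesis
    by (simp add: distrib_right sum.distrib sum_distrib_left mult.assoc)
qed

section \<open>Chart overlaps and the coupling\<close>

text \<open>Openness gives the symmetry argument a full neighbourhood. The preimage under
  \<open>i\<close> is open, the chart is an open map onto its image, and that image is open in the
  coordinate space.\<close>

lemma open_chart_overlap:
  assumes "smooth_manifold A'" "smooth_manifold A" "continuous_on UNIV i" "c' \<in> A'" "c \<in> A"
  shows "open (snd c' ` (fst c' \<inter> i -` fst c))"
proof -
  have hom: "homeomorphism (fst c') (chart_image c') (snd c') (chart_inv c')"
    and op: "open (chart_image c')" and "open (fst c)"
    using assms unfolding smooth_manifold_def by auto
  then have "open (i -` fst c)"
    using assms(3) by (simp add: open_vimage)
  then have "openin (top_of_set (chart_image c')) (snd c' ` (fst c' \<inter> i -` fst c))"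
    by (intro homeomorphism_imp_open_map[OF hom] openin_open_Int)
  then show ?thesis
    using op openin_open_trans by blast
qed

theorem theorem2p1:
  fixes A :: "('p::{t2_space,second_countable_topology}, 'n::finite) chart set"
    and A' :: "('q::{t2_space,second_countable_topology}, 'm::finite) chart set"
    and \<F> :: "('p, 'n) tvec \<Rightarrow> real"
    and i :: "'q \<Rightarrow> 'p"
    and c :: "('p, 'n) chart" and c' :: "('q, 'm) chart"
    and p :: real
    and \<Omega> :: "((real^'m) \<times> (real^'m)) set"
    and Bn :: "(real^'m) \<times> (real^'m) \<Rightarrow> real^'k::finite^'n"
    and Bt :: "(real^'m) \<times> (real^'m) \<Rightarrow> real^'n^'m"
    and Bd :: "(real^'m) \<times> (real^'m) \<Rightarrow> real^'n^'k"
  defines "F \<equiv> \<F> \<circ> tangent_point A c"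
    and "X \<equiv> local_rep c' c i"
  assumes "1 < CARD('m)" and "CARD('m) < CARD('n)" and "CARD('k) = CARD('n) - CARD('m)"
    and "finsler_space A \<F>" and "smooth_manifold A'" and "immersion A' A i"
    and "p > 0"
    and "c \<in> A" and "c' \<in> A'"
    and "open \<Omega>" and "\<Omega> \<subseteq> (snd c' ` (fst c' \<inter> i -` fst c)) \<times> (UNIV - {0})"
    and "moving_frame X \<Omega> Bn Bt Bd"
  shows "(\<forall>a b. \<forall>z\<in>\<Omega>. \<forall>\<zeta>.
            omega_H_check F X a b z \<zeta> = form_of_coeffs F X Bt (LH_check F X Bn Bd) (CH_check F X) a b z \<zeta> \<and>
            omega_V_check p F X a b z \<zeta> = form_of_coeffs F X Bt (LV_check p F X Bn Bd) (CV_check p F X) a b z \<zeta>) \<and>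
         (\<forall>Y. smooth_on Y \<Omega> \<longrightarrow> (\<forall>a. \<forall>z\<in>\<Omega>. \<forall>\<zeta>.
            coupling_DH F X Y a z \<zeta> = covariant_differential (form_of_coeffs F X Bt (LH_check F X Bn Bd) (CH_check F X)) Y a z \<zeta> \<and>
            coupling_DV p F X Y a z \<zeta> = covariant_differential (form_of_coeffs F X Bt (LV_check p F X Bn Bd) (CV_check p F X)) Y a z \<zeta>))"
proof -
  let ?S = "snd c' ` (fst c' \<inter> i -` fst c)"
  have S: "open ?S"
    using assms(4-) by (intro open_chart_overlap[of A' A]) (auto simp: finsler_space_def immersion_def)
  have X: "smooth_on X ?S"
    using \<open>immersion A' A i\<close> \<open>c \<in> A\<close> \<open>c' \<in> A'\<close> unfolding immersion_def X_def by blast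
  have base: "fst z \<in> ?S" if "z \<in> \<Omega>" for z
    using \<open>\<Omega> \<subseteq> ?S \<times> (UNIV - {0})\<close> that by (auto simp: mem_Times_iff)
  have H: "omega_H_check F X a b z \<zeta> = form_of_coeffs F X Bt (LH_check F X Bn Bd) (CH_check F X) a b z \<zeta>"
    if "z \<in> \<Omega>" for a b z \<zeta>
    unfolding omega_H_check_def form_of_coeffs_def LH_check_def CH_check_def
    by (rule pullback_connection_form[OF S X base[OF that] \<open>moving_frame X \<Omega> Bn Bt Bd\<close> that omega_H_def])
  have V: "omega_V_check p F X a b z \<zeta> = form_of_coeffs F X Bt (LV_check p F X Bn Bd) (CV_check p F X) a b z \<zeta>"
    if "z \<in> \<Omega>" for a b z \<zeta>
    unfolding omega_V_check_def form_of_coeffs_def LV_check_def CV_check_def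
    by (rule pullback_connection_form[OF S X base[OF that] \<open>moving_frame X \<Omega> Bn Bt Bd\<close> that omega_V_def])
  \<comment> \<open>Both operators are the differential plus a connection form applied to
    \<open>Y\<close>, so pointwise equality of the forms carries over to them.\<close>
  show ?thesis
    by (simp add: coupling_DH_def coupling_DV_def covariant_differential_def H V)
qed

end
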